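(* Let $\mu$ be a positively homogeneous risk measure on $L^\infty(\mathbb{P})$. Then, for every $X \in L^\infty(\mathbb{P})$, $$\mu(X) = \min_{\substack{Y \in L^\infty(\mathbb{P}) \\ \mu(Y) = 0}} \; \max_{\substack{p \in \Delta(\mathbb{P}) \\ \mathbb{E}_p[Y] \geq 0}} \; \mathbb{E}_p[-X] .$$
   Context: $(\Omega, \mathcal{F}, \mathbb{P})$ is a probability space. $L^\infty(\mathbb{P})$ is the space of equivalence classes of almost surely bounded real-valued random variables, with the usual $L^\infty$ norm and the usual partial order ($X \leq Y$ if $Y - X \geq 0$ almost surely); $e$ denotes the random variable almost surely equal to $1$. The topological dual of $L^\infty(\mathbb{P})$ is the space $\mathsf{ba}(\mathbb{P})$ of finitely additive (signed) measures of bounded variation that are absolutely continuous with respect to $\mathbb{P}$; for $p \in \mathsf{ba}(\mathbb{P})$ and $X \in L^\infty(\mathbb{P})$, $\mathbb{E}_p[X]$ denotes the duality product $\langle p, X\rangle$. $\mathsf{ba}^+(\mathbb{P})$ is the set of positive elements of $\mathsf{ba}(\mathbb{P})$ and $\Delta(\mathbb{P}) := \{ p \in \mathsf{ba}^+(\mathbb{P}) \mid \mathbb{E}_p[e] = 1 \}$ is the set of finitely additive probability measures. A risk measure is a function $\mu : L^\infty(\mathbb{P}) \to \mathbb{R}$ such that, for all $X, Y \in L^\infty(\mathbb{P})$: $X \leq Y$ implies $\mu(X) \geq \mu(Y)$; and $\mu(X + \lambda e) = \mu(X) - \lambda$ for all $\lambda \in \mathbb{R}$. It is positively homogeneous if $\mu(\lambda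 X) = \lambda \mu(X)$ for all $\lambda \geq 0$ and $X \in L^\infty(\mathbb{P})$. Writing $\min$ and $\max$ means that the extrema are attained. *)

theory Defs
  imports "HOL-Probability.Probability"
begin

text \<open>
  Elements of $L^\infty$ are handled through their representatives: measurable functions that are
  almost surely bounded, with equality and order understood almost surely. Every functional below
  (\<open>risk_measure\<close> via its monotonicity clause, \<open>ba_expectation\<close> via absolute continuity) takes the
  same value on almost surely equal representatives, so it is a functional on the classes.
\<close>

definition Linf :: "'a measure \<Rightarrow> ('a \<Rightarrow> real) set" where
  "Linf M = {X \<in> borel_measurable M. \<exists>C. AE \<omega> in M. \<bar>X \<omega>\<bar> \<le> C}"

definition Linf_norm :: "'a measure \<Rightarrow> ('a \<Rightarrow> real) \<Rightarrow> ereal" where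
  "Linf_norm M X = esssup M (\<lambda>\<omega>. ereal \<bar>X \<omega>\<bar>)"

text \<open>
  Signed finitely additive measures are set functions of which only the values on \<open>sets M\<close> matter;
  additivity already forces \<open>p {} = 0\<close>.
\<close>

definition ba :: "'a measure \<Rightarrow> ('a set \<Rightarrow> real) set" where
  "ba M = {p. Measure_Space.additive (sets M) p
            \<and> bdd_above {\<Sum>A\<in>P. \<bar>p A\<bar> | P. finite P \<and> P \<subseteq> sets M \<and> partition_on (space M) P}
            \<and> (\<forall>N\<in>null_sets M. p N = 0)}"

definition ba_pos :: "'a measure \<Rightarrow> ('a set \<Rightarrow> real) set" where
  "ba_pos M = {p \<in> ba M. \<forall>A\<in>sets M. 0 \<le> p A}"

definition ba_simple_expectation :: "'a measure \<Rightarrow> ('a set \<Rightarrow> real) \<Rightarrow> ('a \<Rightarrow> real) \<Rightarrow> real" where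
  "ba_simple_expectation M p S = (\<Sum>y\<in>S ` space M. y * p (S -` {y} \<inter> space M))"

text \<open>
  The duality product is the integral with respect to the finitely additive measure, i.e. the
  continuous extension of the elementary integral from simple functions to $L^\infty$: the common
  limit of the integrals along all sequences of simple functions converging to \<open>X\<close> in the
  $L^\infty$ norm. For \<open>p \<in> ba M\<close> and \<open>X \<in> Linf M\<close> such sequences exist and the limit does not
  depend on the sequence.
\<close>

definition ba_expectation :: "'a measure \<Rightarrow> ('a set \<Rightarrow> real) \<Rightarrow> ('a \<Rightarrow> real) \<Rightarrow> real" where
  "ba_expectation M p X =
     (THE c. \<forall>S. (\<forall>n. simple_function M (S n))
                 \<and> (\<lambda>n. Linf_norm M (\<lambda>\<omega>. S n \<omega> - X \<omega>)) \<longlonglongrightarrow> 0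
              \<longrightarrow> (\<lambda>n. ba_simple_expectation M p (S n)) \<longlonglongrightarrow> c)"

definition fa_probs :: "'a measure \<Rightarrow> ('a set \<Rightarrow> real) set" where
  "fa_probs M = {p \<in> ba_pos M. ba_expectation M p (\<lambda>_. 1) = 1}"

definition risk_measure :: "'a measure \<Rightarrow> (('a \<Rightarrow> real) \<Rightarrow> real) \<Rightarrow> bool" where
  "risk_measure M \<mu> \<longleftrightarrow>
     (\<forall>X\<in>Linf M. \<forall>Y\<in>Linf M. (AE \<omega> in M. X \<omega> \<le> Y \<omega>) \<longrightarrow> \<mu> X \<ge> \<mu> Y) \<and>
     (\<forall>X\<in>Linf M. \<forall>l. \<mu> (\<lambda>\<omega>. X \<omega> + l) = \<mu> X - l)"

definition pos_homogeneous :: "'a measure \<Rightarrow> (('a \<Rightarrow> real) \<Rightarrow> real) \<Rightarrow> bool" where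
  "pos_homogeneous M \<mu> \<longleftrightarrow> (\<forall>X\<in>Linf M. \<forall>l\<ge>0. \<mu> (\<lambda>\<omega>. l * X \<omega>) = l * \<mu> X)"

text \<open>Attained extrema of possibly infinite sets of reals.\<close>

definition is_maximum :: "real set \<Rightarrow> real \<Rightarrow> bool" where
  "is_maximum A m \<longleftrightarrow> m \<in> A \<and> (\<forall>a\<in>A. a \<le> m)"

definition is_minimum :: "real set \<Rightarrow> real \<Rightarrow> bool" where
  "is_minimum A m \<longleftrightarrow> m \<in> A \<and> (\<forall>a\<in>A. m \<le> a)"

end

theory Submission
  imports Defs
begin

text \<open>
  For $Y \in L^\infty$ with $\mu(Y) = 0$ the inner maximum is computed by linear programming duality:
  \[ \max_{p \in \Delta,\ E_p[Y] \ge 0} E_p[-X] = \inf_{t \ge 0} \mathrm{ess\,sup}(tY - X). \]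
  The inequality $\le$ is clear, since $E_p[-X] \le E_p[tY - X] \le \mathrm{ess\,sup}(tY - X)$ for
  every feasible \<open>p\<close> and every \<open>t \<ge> 0\<close>. For the converse and for attainment, put
  $q(Z) = \inf_{t \ge 0} \mathrm{ess\,sup}(Z + tY)$. This is finite because $\mu(Y) = 0$ forces
  $\mathrm{ess\,sup}\,Y \ge 0$, it is sublinear, and it is dominated by the essential supremum. By the
  Hahn-Banach theorem, some linear functional \<open>f\<close> dominated by \<open>q\<close> has $f(-X) = q(-X)$. Domination by
  the essential supremum makes \<open>f\<close> the expectation under a finitely additive probability, and
  $f(-Y) \le q(-Y) \le 0$ makes that probability feasible. So the maximiser comes directly from the
  Hahn-Banach theorem (\<open>constrained_expectation_maximum\<close>).

  The risk measure enters only afterwards. If $tY - X \le c$ almost surely, then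
  $\mu(X) - c = \mu(X + c) \le \mu(tY) = t\mu(Y) = 0$, so every inner maximum is at least $\mu(X)$. The
  choice $Y = X + \mu(X)$ gives equality, as \<open>t = 1\<close> then yields the bound
  $\mathrm{ess\,sup}(Y - X) = \mu(X)$.

  The operation that turns the essential supremum into \<open>q\<close> (called \<open>tilt\<close> below) also drives the proof
  of the Hahn-Banach theorem (\<open>dominated_linear_functional\<close>), which rests on the fact that a minimal
  sublinear functional is linear. The representation of \<open>f\<close> rests on the fact that
  the integral against a positive finitely additive measure is well defined on $L^\infty$: simple
  functions are dense, and the elementary integral is Lipschitz in the norm.
\<close>

section \<open>Sublinear functionals and the Hahn-Banach theorem\<close>

locale function_space =
  fixes V :: "('a \<Rightarrow> real) set"
  assumes zero_mem: "(\<lambda>_. 0) \<in> V"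
    and add_mem: "f \<in> V \<Longrightarrow> g \<in> V \<Longrightarrow> (\<lambda>\<omega>. f \<omega> + g \<omega>) \<in> V"
    and scale_mem: "f \<in> V \<Longrightarrow> (\<lambda>\<omega>. c * f \<omega>) \<in> V"
begin

lemma uminus_mem: "f \<in> V \<Longrightarrow> (\<lambda>\<omega>. - f \<omega>) \<in> V"
  using scale_mem[of f "-1"] by simp

lemma add_scale_mem: "f \<in> V \<Longrightarrow> g \<in> V \<Longrightarrow> (\<lambda>\<omega>. f \<omega> + c * g \<omega>) \<in> V"
  using add_mem[OF _ scale_mem] .

definition sublinear :: "(('a \<Rightarrow> real) \<Rightarrow> real) \<Rightarrow> bool" where
  "sublinear p \<longleftrightarrow>
     (\<forall>f\<in>V. \<forall>g\<in>V. p (\<lambda>\<omega>. f \<omega> + g \<omega>) \<le> p f + p g) \<and>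
     (\<forall>f\<in>V. \<forall>t\<ge>0. p (\<lambda>\<omega>. t * f \<omega>) = t * p f)"

definition linear_functional :: "(('a \<Rightarrow> real) \<Rightarrow> real) \<Rightarrow> bool" where
  "linear_functional p \<longleftrightarrow>
     (\<forall>f\<in>V. \<forall>g\<in>V. p (\<lambda>\<omega>. f \<omega> + g \<omega>) = p f + p g) \<and>
     (\<forall>f\<in>V. \<forall>t. p (\<lambda>\<omega>. t * f \<omega>) = t * p f)"

lemma sublinear_add: "sublinear p \<Longrightarrow> f \<in> V \<Longrightarrow> g \<in> V \<Longrightarrow> p (\<lambda>\<omega>. f \<omega> + g \<omega>) \<le> p f + p g"
  by (simp add: sublinear_def)

lemma sublinear_scale: "sublinear p \<Longrightarrow> f \<in> V \<Longrightarrow> 0 \<le> t \<Longrightarrow> p (\<lambda>\<omega>. t * f \<omega>) = t * p f"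
  by (simp add: sublinear_def)

lemma sublinear_zero: "sublinear p \<Longrightarrow> p (\<lambda>_. 0) = 0"
  using sublinear_scale[OF _ zero_mem, of p 0] by simp

lemma sublinear_minus:
  assumes "sublinear p" "f \<in> V"
  shows "- p (\<lambda>\<omega>. - f \<omega>) \<le> p f"
  using sublinear_add[OF assms uminus_mem[OF assms(2)]] sublinear_zero[OF assms(1)] by simp

text \<open>
  Positive homogeneity only needs the inequality, as the reverse one is the same statement for the
  inverse factor.
\<close>

lemma sublinearI:
  assumes "\<And>f g. f \<in> V \<Longrightarrow> g \<in> V \<Longrightarrow> p (\<lambda>\<omega>. f \<omega> + g \<omega>) \<le> p f + p g"
    and "p (\<lambda>_. 0) = 0"
    and scale: "\<And>f t. f \<in> V \<Longrightarrow> 0 < t \<Longrightarrow> p (\<lambda>\<omega>. t * f \<omega>) \<le> t * p f"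
  shows "sublinear p"
  unfolding sublinear_def
proof (intro conjI ballI allI impI)
  fix f and t :: real assume f: "f \<in> V" and "0 \<le> t"
  show "p (\<lambda>\<omega>. t * f \<omega>) = t * p f"
  proof (cases "t = 0")
    case False
    with \<open>0 \<le> t\<close> have t: "0 < t" by simp
    have "p (\<lambda>\<omega>. (1/t) * (t * f \<omega>)) \<le> (1/t) * p (\<lambda>\<omega>. t * f \<omega>)"
      using t by (intro scale scale_mem f) auto
    hence "t * p f \<le> p (\<lambda>\<omega>. t * f \<omega>)"
      using t by (simp add: field_simps)
    with scale[OF f t] show ?thesis by simp
  qed (use assms(2) in simp)
qed (use assms(1) in blast)

text \<open>
  If $c \le p(x)$, this is the largest sublinear functional below \<open>p\<close> whose value at $-x$ is at most $-c$,
  that is, whose linear minorants take a value of at least \<open>c\<close> at \<open>x\<close>.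
\<close>

definition tilt :: "(('a \<Rightarrow> real) \<Rightarrow> real) \<Rightarrow> ('a \<Rightarrow> real) \<Rightarrow> real \<Rightarrow> ('a \<Rightarrow> real) \<Rightarrow> real" where
  "tilt p x c f = (INF t\<in>{0..}. p (\<lambda>\<omega>. f \<omega> + t * x \<omega>) - t * c)"

context
  fixes p x c
  assumes p: "sublinear p" and x: "x \<in> V" and c: "c \<le> p x"
begin

text \<open>
  The infimum in \<open>tilt\<close> is over a set bounded below, because
  $t c \le t p(x) = p(tx) \le p(f + tx) + p(-f)$; this is where $c \le p(x)$ is needed.
\<close>

lemma tilt_lower:
  assumes f: "f \<in> V" and t: "0 \<le> t"
  shows "- p (\<lambda>\<omega>. - f \<omega>) \<le> p (\<lambda>\<omega>. f \<omega> + t * x \<omega>) - t * c"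
proof -
  have "p (\<lambda>\<omega>. (f \<omega> + t * x \<omega>) + - f \<omega>) \<le> p (\<lambda>\<omega>. f \<omega> + t * x \<omega>) + p (\<lambda>\<omega>. - f \<omega>)"
    by (intro sublinear_add p add_scale_mem uminus_mem f x)
  moreover have "p (\<lambda>\<omega>. t * x \<omega>) = t * p x"
    by (rule sublinear_scale[OF p x t])
  moreover have "t * c \<le> t * p x" using c t by (rule mult_left_mono)
  ultimately show ?thesis by simp
qed

lemma tilt_le:
  assumes "f \<in> V" "0 \<le> t"
  shows "tilt p x c f \<le> p (\<lambda>\<omega>. f \<omega> + t * x \<omega>) - t * c"
  unfolding tilt_def using assms tilt_lower[OF assms(1)]
  by (intro cINF_lower bdd_belowI2[where m="- p (\<lambda>\<omega>. - f \<omega>)"]) auto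

lemma tilt_greatest:
  assumes "\<And>t. 0 \<le> t \<Longrightarrow> a \<le> p (\<lambda>\<omega>. f \<omega> + t * x \<omega>) - t * c"
  shows "a \<le> tilt p x c f"
  unfolding tilt_def using assms by (intro cINF_greatest) auto

lemma tilt_le_self: "f \<in> V \<Longrightarrow> tilt p x c f \<le> p f"
  using tilt_le[of f 0] by simp

lemma tilt_uminus: "tilt p x c (\<lambda>\<omega>. - x \<omega>) \<le> - c"
  using tilt_le[OF uminus_mem[OF x], of 1] sublinear_zero[OF p] by simp

lemma sublinear_tilt: "sublinear (tilt p x c)"
proof (rule sublinearI)
  fix f g assume f: "f \<in> V" and g: "g \<in> V"
  have le: "tilt p x c (\<lambda>\<omega>. f \<omega> + g \<omega>) \<le>
      (p (\<lambda>\<omega>. f \<omega> + s * x \<omega>) - s * c) + (p (\<lambda>\<omega>. g \<omega> + t * x \<omega>) - t * c)"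
    if "0 \<le> s" "0 \<le> t" for s t
  proof -
    have "tilt p x c (\<lambda>\<omega>. f \<omega> + g \<omega>) \<le> p (\<lambda>\<omega>. (f \<omega> + g \<omega>) + (s + t) * x \<omega>) - (s + t) * c"
      using that by (intro tilt_le add_mem f g) auto
    also have "(\<lambda>\<omega>. (f \<omega> + g \<omega>) + (s + t) * x \<omega>)
        = (\<lambda>\<omega>. (f \<omega> + s * x \<omega>) + (g \<omega> + t * x \<omega>))"
      by (simp add: algebra_simps)
    also have "p \<dots> \<le> p (\<lambda>\<omega>. f \<omega> + s * x \<omega>) + p (\<lambda>\<omega>. g \<omega> + t * x \<omega>)"
      by (intro sublinear_add p add_scale_mem f g x)
    finally show ?thesis by (simp add: algebra_simps)
  qed
  have "tilt p x c (\<lambda>\<omega>. f \<omega> + g \<omega>) - (p (\<lambda>\<omega>. f \<omega> + s * x \<omega>) - s * c) \<le> tilt p x c g"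
    if "0 \<le> s" for s
    using le[OF that] by (intro tilt_greatest) (simp add: algebra_simps)
  hence "tilt p x c (\<lambda>\<omega>. f \<omega> + g \<omega>) - tilt p x c g \<le> tilt p x c f"
    by (intro tilt_greatest) (simp add: algebra_simps)
  thus "tilt p x c (\<lambda>\<omega>. f \<omega> + g \<omega>) \<le> tilt p x c f + tilt p x c g" by simp
next
  have "0 \<le> tilt p x c (\<lambda>_. 0)"
    using tilt_lower[OF zero_mem] sublinear_zero[OF p] by (intro tilt_greatest) simp
  with tilt_le_self[OF zero_mem] show "tilt p x c (\<lambda>_. 0) = 0"
    using sublinear_zero[OF p] by simp
next
  fix f and s :: real assume f: "f \<in> V" and s: "0 < s"
  have "tilt p x c (\<lambda>\<omega>. s * f \<omega>) / s \<le> p (\<lambda>\<omega>. f \<omega> + t * x \<omega>) - t * c" if t: "0 \<le> t" for t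
  proof -
    have "tilt p x c (\<lambda>\<omega>. s * f \<omega>) \<le> p (\<lambda>\<omega>. s * f \<omega> + (s * t) * x \<omega>) - (s * t) * c"
      using s t by (intro tilt_le scale_mem f) auto
    also have "(\<lambda>\<omega>. s * f \<omega> + (s * t) * x \<omega>) = (\<lambda>\<omega>. s * (f \<omega> + t * x \<omega>))"
      by (simp add: algebra_simps)
    also have "p \<dots> = s * p (\<lambda>\<omega>. f \<omega> + t * x \<omega>)"
      using s by (intro sublinear_scale p add_scale_mem f x) auto
    finally show ?thesis using s by (simp add: field_simps)
  qed
  hence "tilt p x c (\<lambda>\<omega>. s * f \<omega>) / s \<le> tilt p x c f" by (rule tilt_greatest)
  thus "tilt p x c (\<lambda>\<omega>. s * f \<omega>) \<le> s * tilt p x c f" using s by (simp add: field_simps)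
qed

end

text \<open>
  Tilting a minimal \<open>p\<close> by \<open>g\<close> and $p(g)$ cannot change it, so $p(f) \le p(f + g) - p(g)$. This is the
  missing half of additivity.
\<close>

lemma minimal_sublinear_imp_linear:
  assumes p: "sublinear p"
    and min: "\<And>q. sublinear q \<Longrightarrow> (\<forall>f\<in>V. q f \<le> p f) \<Longrightarrow> \<forall>f\<in>V. q f = p f"
  shows "linear_functional p"
proof -
  have add: "p (\<lambda>\<omega>. f \<omega> + g \<omega>) = p f + p g" if f: "f \<in> V" and g: "g \<in> V" for f g
  proof -
    have "\<forall>f\<in>V. tilt p g (p g) f = p f"
      by (intro min sublinear_tilt p g ballI tilt_le_self order_refl)
    with f tilt_le[OF p g order_refl f, of 1] have "p f \<le> p (\<lambda>\<omega>. f \<omega> + g \<omega>) - p g" by simp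
    with sublinear_add[OF p f g] show ?thesis by simp
  qed
  have "p (\<lambda>\<omega>. t * f \<omega>) = t * p f" if f: "f \<in> V" for f t
  proof (cases "0 \<le> t")
    case False
    have "p (\<lambda>\<omega>. t * f \<omega> + (- t) * f \<omega>) = p (\<lambda>\<omega>. t * f \<omega>) + p (\<lambda>\<omega>. (- t) * f \<omega>)"
      by (intro add scale_mem f)
    moreover have "p (\<lambda>\<omega>. (- t) * f \<omega>) = (- t) * p f"
      using False by (intro sublinear_scale p f) auto
    ultimately show ?thesis using sublinear_zero[OF p] by simp
  qed (rule sublinear_scale[OF p f])
  with add show ?thesis by (simp add: linear_functional_def)
qed

text \<open>
  Zorn's lemma applies since the infimum of a chain of sublinear functionals below \<open>q\<close> is again one: it
  is finite because each member is at least $-q(-f)$ at \<open>f\<close>, and subadditive because any two members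
  can be replaced by the smaller one.
\<close>

lemma exists_minimal_sublinear:
  assumes q: "sublinear q"
  obtains p where "sublinear p" "\<And>f. f \<in> V \<Longrightarrow> p f \<le> q f"
    "\<And>r. sublinear r \<Longrightarrow> (\<forall>f\<in>V. r f \<le> p f) \<Longrightarrow> \<forall>f\<in>V. r f = p f"
proof -
  \<comment> \<open>Restriction to extensional functions makes the pointwise order on \<open>V\<close> antisymmetric.\<close>
  define A where "A = {p \<in> extensional V. sublinear p \<and> (\<forall>f\<in>V. p f \<le> q f)}"
  define P where "P a b \<longleftrightarrow> (\<forall>f\<in>V. b f \<le> a f)" for a b :: "('a \<Rightarrow> real) \<Rightarrow> real"
  have sub_restrict: "sublinear (restrict p V) \<longleftrightarrow> sublinear p" for p
    by (simp add: sublinear_def add_mem scale_mem)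
  have "\<exists>m\<in>A. \<forall>a\<in>A. P m a \<longrightarrow> a = m"
  proof (rule predicate_Zorn)
    show "partial_order_on A (relation_of P A)"
    proof (rule partial_order_on_relation_ofI)
      fix a b assume "a \<in> A" "b \<in> A" "P a b" "P b a"
      thus "a = b"
        unfolding A_def P_def by (intro extensionalityI[of _ V]) (auto intro: antisym)
    qed (auto simp: P_def intro: order_trans)
  next
    fix C assume C: "C \<in> Chains (relation_of P A)"
    have CA: "C \<subseteq> A" using C by (auto simp: Chains_def relation_of_def)
    show "\<exists>u\<in>A. \<forall>a\<in>C. P a u"
    proof (cases "C = {}")
      case True
      have "restrict q V \<in> A" using q by (simp add: A_def sub_restrict)
      with True show ?thesis by blast
    next
      case False
      define u where "u f = (INF p\<in>C. p f)" for f
      have sub: "sublinear p" if "p \<in> C" for p using that CA by (auto simp: A_def)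
      have le_q: "p f \<le> q f" if "p \<in> C" "f \<in> V" for p f using that CA by (auto simp: A_def)
      have lower: "u f \<le> p f" if p: "p \<in> C" and f: "f \<in> V" for p f
        unfolding u_def
      proof (rule cINF_lower[OF bdd_belowI2 p])
        fix r assume r: "r \<in> C"
        show "- q (\<lambda>\<omega>. - f \<omega>) \<le> r f"
          using sublinear_minus[OF sub[OF r] f] le_q[OF r uminus_mem[OF f]] by simp
      qed
      have greatest: "a \<le> u f" if "\<And>p. p \<in> C \<Longrightarrow> a \<le> p f" for a f
        unfolding u_def using that False by (intro cINF_greatest)
      have "sublinear u"
      proof (rule sublinearI)
        fix f g assume f: "f \<in> V" and g: "g \<in> V"
        have le: "u (\<lambda>\<omega>. f \<omega> + g \<omega>) \<le> a f + b g" if a: "a \<in> C" and b: "b \<in> C" for a b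
        proof -
          have "P a b \<or> P b a"
            using C a b by (auto simp: Chains_def relation_of_def)
          then obtain k where k: "k \<in> C" "k f \<le> a f" "k g \<le> b g"
            using a b f g by (auto simp: P_def)
          have "u (\<lambda>\<omega>. f \<omega> + g \<omega>) \<le> k (\<lambda>\<omega>. f \<omega> + g \<omega>)"
            by (intro lower k add_mem f g)
          also have "\<dots> \<le> k f + k g" by (intro sublinear_add sub k f g)
          finally show ?thesis using k by simp
        qed
        have "u (\<lambda>\<omega>. f \<omega> + g \<omega>) - a f \<le> u g" if "a \<in> C" for a
          using le[OF that] by (intro greatest) (simp add: algebra_simps)
        hence "u (\<lambda>\<omega>. f \<omega> + g \<omega>) - u g \<le> u f"
          by (intro greatest) (simp add: algebra_simps)
        thus "u (\<lambda>\<omega>. f \<omega> + g \<omega>) \<le> u f + u g" by simp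
      next
        show "u (\<lambda>_. 0) = 0"
        proof (rule antisym)
          obtain p where "p \<in> C" using False by blast
          with lower[OF _ zero_mem] sublinear_zero[OF sub] show "u (\<lambda>_. 0) \<le> 0" by metis
          show "0 \<le> u (\<lambda>_. 0)" by (rule greatest) (simp add: sublinear_zero[OF sub])
        qed
      next
        fix f and t :: real assume f: "f \<in> V" and t: "0 < t"
        have "u (\<lambda>\<omega>. t * f \<omega>) / t \<le> u f"
        proof (rule greatest)
          fix p assume p: "p \<in> C"
          have "u (\<lambda>\<omega>. t * f \<omega>) \<le> t * p f"
            using lower[OF p scale_mem[OF f], of t] sublinear_scale[OF sub[OF p] f, of t] t by simp
          thus "u (\<lambda>\<omega>. t * f \<omega>) / t \<le> p f" using t by (simp add: field_simps)
        qed
        thus "u (\<lambda>\<omega>. t * f \<omega>) \<le> t * u f" using t by (simp add: field_simps)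
      qed
      moreover have "u f \<le> q f" if f: "f \<in> V" for f
      proof -
        obtain p where "p \<in> C" using False by blast
        with lower[of p f] le_q[of p f] f show ?thesis by simp
      qed
      ultimately have "restrict u V \<in> A" by (simp add: A_def sub_restrict)
      moreover have "\<forall>a\<in>C. P a (restrict u V)" using lower by (simp add: P_def)
      ultimately show ?thesis by blast
    qed
  qed
  then obtain m where m: "m \<in> A" and min: "\<And>a. a \<in> A \<Longrightarrow> P m a \<Longrightarrow> a = m" by blast
  show thesis
  proof (rule that)
    show "sublinear m" and m_le: "\<And>f. f \<in> V \<Longrightarrow> m f \<le> q f" using m by (auto simp: A_def)
    fix r assume r: "sublinear r" and le: "\<forall>f\<in>V. r f \<le> m f"
    have "restrict r V = m"
    proof (rule min)
      show "restrict r V \<in> A" using r le m_le by (fastforce simp: A_def sub_restrict)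
      show "P m (restrict r V)" using le by (simp add: P_def)
    qed
    thus "\<forall>f\<in>V. r f = m f" by auto
  qed
qed

text \<open>
  Hahn-Banach theorem with a prescribed point of contact. Before a minimal sublinear functional is
  taken, \<open>q\<close> is tilted by \<open>x\<close> and $q(x)$, so that every linear functional below the result takes at
  least the value $q(x)$ at \<open>x\<close>.
\<close>

theorem dominated_linear_functional:
  assumes q: "sublinear q" and x: "x \<in> V"
  shows "\<exists>p. linear_functional p \<and> (\<forall>f\<in>V. p f \<le> q f) \<and> p x = q x"
proof -
  obtain p where p: "sublinear p" and le: "\<And>f. f \<in> V \<Longrightarrow> p f \<le> tilt q x (q x) f"
    and min: "\<And>r. sublinear r \<Longrightarrow> (\<forall>f\<in>V. r f \<le> p f) \<Longrightarrow> \<forall>f\<in>V. r f = p f"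
    by (rule exists_minimal_sublinear[OF sublinear_tilt[OF q x order_refl]]) (rule that)
  have le_q: "p f \<le> q f" if "f \<in> V" for f
    using le[OF that] tilt_le_self[OF q x order_refl that] by simp
  have "p (\<lambda>\<omega>. - x \<omega>) \<le> - q x"
    using le[OF uminus_mem[OF x]] tilt_uminus[OF q x order_refl] by simp
  hence "q x \<le> p x" using sublinear_minus[OF p x] by simp
  with le_q[OF x] have "p x = q x" by (rule antisym)
  with minimal_sublinear_imp_linear[OF p min] le_q show ?thesis by blast
qed

end

section \<open>Integration with respect to a positive finitely additive measure\<close>

lemma additive_sum_real:
  fixes p :: "'a set \<Rightarrow> real"
  assumes add: "Measure_Space.additive (sets M) p" and "finite I"
    and "\<And>i. i \<in> I \<Longrightarrow> A i \<in> sets M" and "disjoint_family_on A I"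
  shows "p (\<Union>i\<in>I. A i) = (\<Sum>i\<in>I. p (A i))"
  using assms(2-)
proof (induction I)
  case empty
  have "p ({} \<union> {}) = p {} + p {}" using add unfolding Measure_Space.additive_def by blast
  thus ?case by simp
next
  case (insert i I)
  have "p (A i \<union> (\<Union>j\<in>I. A j)) = p (A i) + p (\<Union>j\<in>I. A j)"
  proof -
    have "A i \<in> sets M" "(\<Union>j\<in>I. A j) \<in> sets M" using insert by auto
    moreover have "A i \<inter> (\<Union>j\<in>I. A j) = {}"
      using insert.hyps(2) insert.prems(2) by (auto simp: disjoint_family_on_def)
    ultimately show ?thesis using add unfolding Measure_Space.additive_def by blast
  qed
  moreover have "disjoint_family_on A I"
    using insert.prems(2) by (auto simp: disjoint_family_on_def)
  ultimately show ?case using insert by simp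
qed

text \<open>
  The elementary integral may be computed on any finite measurable partition finer than the level sets.
  Applied to a pair of simple functions, this puts both integrals on a common partition.
\<close>

lemma ba_simple_expectation_comp:
  assumes add: "Measure_Space.additive (sets M) p" and T: "simple_function M T"
  shows "ba_simple_expectation M p (\<lambda>\<omega>. h (T \<omega>))
    = (\<Sum>b\<in>T ` space M. h b * p (T -` {b} \<inter> space M))"
proof -
  let ?B = "T ` space M" and ?Y = "(\<lambda>\<omega>. h (T \<omega>)) ` space M"
  have fin: "finite ?B" using T by (rule simple_functionD)
  have split: "y * p ((\<lambda>\<omega>. h (T \<omega>)) -` {y} \<inter> space M)
      = (\<Sum>b\<in>{b\<in>?B. h b = y}. h b * p (T -` {b} \<inter> space M))" for y
  proof -
    have "(\<lambda>\<omega>. h (T \<omega>)) -` {y} \<inter> space M = (\<Union>b\<in>{b\<in>?B. h b = y}. T -` {b} \<inter> space M)"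
      by auto
    moreover have "p \<dots> = (\<Sum>b\<in>{b\<in>?B. h b = y}. p (T -` {b} \<inter> space M))"
      using fin simple_functionD(2)[OF T]
      by (intro additive_sum_real[OF add]) (auto simp: disjoint_family_on_def)
    ultimately show ?thesis by (simp add: sum_distrib_left)
  qed
  show ?thesis
    unfolding ba_simple_expectation_def split using fin finite_imageI[OF fin, of h]
    by (intro sum.group) (auto simp: image_image)
qed

lemma Linf_borel_measurable: "X \<in> Linf M \<Longrightarrow> X \<in> borel_measurable M"
  by (simp add: Linf_def)

lemma Linf_I:
  assumes "X \<in> borel_measurable M" "AE \<omega> in M. \<bar>X \<omega>\<bar> \<le> C"
  shows "X \<in> Linf M"
  using assms by (auto simp: Linf_def)

lemma Linf_bound:
  assumes "X \<in> Linf M"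
  obtains C where "AE \<omega> in M. \<bar>X \<omega>\<bar> \<le> C"
  using assms by (auto simp: Linf_def)

lemma Linf_const: "(\<lambda>_. c) \<in> Linf M"
  by (rule Linf_I[of _ _ "\<bar>c\<bar>"]) auto

lemma Linf_add_scale:
  assumes X: "X \<in> Linf M" and Y: "Y \<in> Linf M"
  shows "(\<lambda>\<omega>. X \<omega> + c * Y \<omega>) \<in> Linf M"
proof -
  obtain A where "AE \<omega> in M. \<bar>X \<omega>\<bar> \<le> A" using X by (rule Linf_bound)
  moreover obtain B where "AE \<omega> in M. \<bar>Y \<omega>\<bar> \<le> B" using Y by (rule Linf_bound)
  ultimately have "AE \<omega> in M. \<bar>X \<omega> + c * Y \<omega>\<bar> \<le> A + \<bar>c\<bar> * B"
  proof eventually_elim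
    case (elim \<omega>)
    have "\<bar>X \<omega> + c * Y \<omega>\<bar> \<le> \<bar>X \<omega>\<bar> + \<bar>c\<bar> * \<bar>Y \<omega>\<bar>"
      using abs_triangle_ineq[of "X \<omega>" "c * Y \<omega>"] by (simp add: abs_mult)
    also have "\<dots> \<le> A + \<bar>c\<bar> * B"
      using elim by (intro add_mono mult_left_mono) auto
    finally show ?case .
  qed
  moreover have "(\<lambda>\<omega>. X \<omega> + c * Y \<omega>) \<in> borel_measurable M"
    using X Y by (intro borel_measurable_add borel_measurable_times borel_measurable_const
        Linf_borel_measurable)
  ultimately show ?thesis by (rule Linf_I[rotated])
qed

lemma Linf_scale: "X \<in> Linf M \<Longrightarrow> (\<lambda>\<omega>. c * X \<omega>) \<in> Linf M"
  using Linf_add_scale[OF Linf_const, of _ M 0 c] by simp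

lemma Linf_add: "X \<in> Linf M \<Longrightarrow> Y \<in> Linf M \<Longrightarrow> (\<lambda>\<omega>. X \<omega> + Y \<omega>) \<in> Linf M"
  using Linf_add_scale[of X M Y 1] by simp

lemma Linf_uminus: "X \<in> Linf M \<Longrightarrow> (\<lambda>\<omega>. - X \<omega>) \<in> Linf M"
  using Linf_scale[of X M "-1"] by simp

lemma simple_function_Linf:
  fixes S :: "'a \<Rightarrow> real"
  assumes S: "simple_function M S"
  shows "S \<in> Linf M"
proof (rule Linf_I)
  have "finite (S ` space M)" using S by (rule simple_functionD)
  hence "\<bar>S \<omega>\<bar> \<le> Max (abs ` S ` space M)" if "\<omega> \<in> space M" for \<omega>
    using that by (intro Max_ge) auto
  thus "AE \<omega> in M. \<bar>S \<omega>\<bar> \<le> Max (abs ` S ` space M)" by (intro AE_I2)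
qed (rule borel_measurable_simple_function[OF S])

lemma simple_function_add_scale:
  fixes S T :: "'a \<Rightarrow> real"
  shows "simple_function M S \<Longrightarrow> simple_function M T \<Longrightarrow> simple_function M (\<lambda>\<omega>. S \<omega> + c * T \<omega>)"
  by (intro simple_function_add simple_function_mult simple_function_const)

definition approximates :: "'a measure \<Rightarrow> (nat \<Rightarrow> 'a \<Rightarrow> real) \<Rightarrow> ('a \<Rightarrow> real) \<Rightarrow> bool" where
  "approximates M S X \<longleftrightarrow> (\<forall>n. simple_function M (S n)) \<and>
     (\<lambda>n. Linf_norm M (\<lambda>\<omega>. S n \<omega> - X \<omega>)) \<longlonglongrightarrow> 0"

context prob_space
begin

text \<open>
  In terms of representatives, norm convergence is almost sure uniform approximation. On a probability
  space the essential supremum of a nonnegative function is nonnegative, so upper bounds suffice.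
\<close>

lemma approximates_iff:
  assumes X: "X \<in> Linf M"
  shows "approximates M S X \<longleftrightarrow> (\<forall>n. simple_function M (S n)) \<and>
    (\<forall>e>0. \<forall>\<^sub>F n in sequentially. AE \<omega> in M. \<bar>S n \<omega> - X \<omega>\<bar> \<le> e)"
proof (cases "\<forall>n. simple_function M (S n)")
  case True
  let ?N = "\<lambda>n. Linf_norm M (\<lambda>\<omega>. S n \<omega> - X \<omega>)"
  have meas: "(\<lambda>\<omega>. ereal \<bar>S n \<omega> - X \<omega>\<bar>) \<in> borel_measurable M" for n
  proof -
    have [measurable]: "S n \<in> borel_measurable M" "X \<in> borel_measurable M"
      using True X by (auto intro: borel_measurable_simple_function Linf_borel_measurable)
    show ?thesis by measurable
  qed
  have le_iff: "?N n \<le> ereal e \<longleftrightarrow> (AE \<omega> in M. \<bar>S n \<omega> - X \<omega>\<bar> \<le> e)" for n e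
  proof
    assume le: "?N n \<le> ereal e"
    have "AE \<omega> in M. ereal \<bar>S n \<omega> - X \<omega>\<bar> \<le> ?N n"
      unfolding Linf_norm_def by (rule esssup_AE)
    thus "AE \<omega> in M. \<bar>S n \<omega> - X \<omega>\<bar> \<le> e"
    proof eventually_elim
      case (elim \<omega>)
      with le have "ereal \<bar>S n \<omega> - X \<omega>\<bar> \<le> ereal e" by (rule order_trans[rotated])
      thus ?case by simp
    qed
  next
    assume "AE \<omega> in M. \<bar>S n \<omega> - X \<omega>\<bar> \<le> e"
    thus "?N n \<le> ereal e"
      unfolding Linf_norm_def by (intro esssup_I meas) simp
  qed
  have nonneg: "0 \<le> ?N n" for n
  proof -
    have "esssup M (\<lambda>_. 0::ereal) \<le> ?N n"
      unfolding Linf_norm_def by (rule esssup_mono) auto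
    thus ?thesis using esssup_const[of M "0::ereal"] emeasure_space_1 by simp
  qed
  have "?N \<longlonglongrightarrow> 0 \<longleftrightarrow> (\<forall>e>0. \<forall>\<^sub>F n in sequentially. ?N n \<le> ereal e)"
  proof
    assume lim: "?N \<longlonglongrightarrow> 0"
    show "\<forall>e>0. \<forall>\<^sub>F n in sequentially. ?N n \<le> ereal e"
    proof (intro allI impI)
      fix e :: real assume "0 < e"
      hence "\<forall>\<^sub>F n in sequentially. ?N n < ereal e"
        by (intro order_tendstoD[OF lim]) simp
      thus "\<forall>\<^sub>F n in sequentially. ?N n \<le> ereal e"
        by (rule eventually_mono) simp
    qed
  next
    assume small: "\<forall>e>0. \<forall>\<^sub>F n in sequentially. ?N n \<le> ereal e"
    show "?N \<longlonglongrightarrow> 0"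
    proof (rule order_tendstoI)
      fix a :: ereal assume "a < 0"
      thus "\<forall>\<^sub>F n in sequentially. a < ?N n"
        using nonneg by (intro always_eventually allI) (rule less_le_trans)
    next
      fix a :: ereal assume "0 < a"
      then obtain e where e: "0 < ereal e" "ereal e < a" using ereal_dense2 by blast
      hence "\<forall>\<^sub>F n in sequentially. ?N n \<le> ereal e" using small by simp
      thus "\<forall>\<^sub>F n in sequentially. ?N n < a"
        by (rule eventually_mono) (rule le_less_trans[OF _ e(2)])
    qed
  qed
  with True show ?thesis by (simp add: approximates_def le_iff)
qed (auto simp: approximates_def)

lemma exists_approximates:
  assumes X: "X \<in> Linf M"
  obtains S where "approximates M S X"
proof -
  obtain C where C: "AE \<omega> in M. \<bar>X \<omega>\<bar> \<le> C" using X by (rule Linf_bound)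
  \<comment> \<open>Clamping gives a representative bounded everywhere, so that rounding it down to a multiple of
      \<open>1 / Suc n\<close> leaves only finitely many values.\<close>
  define Z where "Z \<omega> = max (- C) (min C (X \<omega>))" for \<omega>
  define S where "S n \<omega> = real_of_int \<lfloor>real (Suc n) * Z \<omega>\<rfloor> / real (Suc n)" for n \<omega>
  have [measurable]: "X \<in> borel_measurable M" using X by (rule Linf_borel_measurable)
  have [measurable]: "Z \<in> borel_measurable M" unfolding Z_def[abs_def] by measurable
  have simple: "simple_function M (S n)" for n
  proof (rule simple_function_borel_measurable)
    show "S n \<in> borel_measurable M" unfolding S_def[abs_def] by measurable
    have "- \<bar>C\<bar> \<le> Z \<omega> \<and> Z \<omega> \<le> \<bar>C\<bar>" for \<omega> by (auto simp: Z_def)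
    hence "\<lfloor>real (Suc n) * Z \<omega>\<rfloor> \<in> {\<lfloor>real (Suc n) * - \<bar>C\<bar>\<rfloor>..\<lfloor>real (Suc n) * \<bar>C\<bar>\<rfloor>}" for \<omega>
      unfolding atLeastAtMost_iff by (intro conjI floor_mono mult_left_mono) auto
    hence "S n ` space M \<subseteq> (\<lambda>k. real_of_int k / real (Suc n)) `
        {\<lfloor>real (Suc n) * - \<bar>C\<bar>\<rfloor>..\<lfloor>real (Suc n) * \<bar>C\<bar>\<rfloor>}"
      unfolding S_def by blast
    thus "finite (S n ` space M)" by (rule finite_subset) simp
  qed
  have close: "AE \<omega> in M. \<bar>S n \<omega> - X \<omega>\<bar> \<le> 1 / real (Suc n)" for n
    using C
  proof eventually_elim
    case (elim \<omega>)
    hence "Z \<omega> = X \<omega>" by (auto simp: Z_def)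
    moreover have "\<bar>real_of_int \<lfloor>real (Suc n) * X \<omega>\<rfloor> - real (Suc n) * X \<omega>\<bar> \<le> 1" by linarith
    hence "\<bar>real_of_int \<lfloor>real (Suc n) * X \<omega>\<rfloor> - real (Suc n) * X \<omega>\<bar> / real (Suc n)
        \<le> 1 / real (Suc n)" by (rule divide_right_mono) simp
    moreover have "real_of_int \<lfloor>real (Suc n) * X \<omega>\<rfloor> / real (Suc n) - X \<omega>
        = (real_of_int \<lfloor>real (Suc n) * X \<omega>\<rfloor> - real (Suc n) * X \<omega>) / real (Suc n)"
      by (simp add: diff_divide_distrib del: of_nat_Suc)
    ultimately show ?case by (simp add: S_def abs_divide del: of_nat_Suc)
  qed
  have "\<forall>\<^sub>F n in sequentially. AE \<omega> in M. \<bar>S n \<omega> - X \<omega>\<bar> \<le> e" if "0 < e" for e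
  proof -
    have "\<forall>\<^sub>F n in sequentially. 1 / real (Suc n) < e"
      using that by (intro order_tendstoD[OF lim_1_over_n[THEN LIMSEQ_Suc]])
    thus ?thesis
    proof eventually_elim
      case (elim n)
      from close[of n] show ?case by eventually_elim (use elim in linarith)
    qed
  qed
  with simple have "approximates M S X" by (simp add: approximates_iff[OF X])
  thus thesis by (rule that)
qed

end

locale fa_measure = prob_space +
  fixes p :: "'a set \<Rightarrow> real"
  assumes ba_pos: "p \<in> ba_pos M"
begin

lemma additive: "Measure_Space.additive (sets M) p"
  using ba_pos by (simp add: ba_pos_def ba_def)

lemma null: "N \<in> null_sets M \<Longrightarrow> p N = 0"
  using ba_pos by (simp add: ba_pos_def ba_def)

lemma nonneg: "A \<in> sets M \<Longrightarrow> 0 \<le> p A"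
  using ba_pos by (simp add: ba_pos_def)

lemma simple_add_scale:
  assumes S: "simple_function M S" and T: "simple_function M T"
  shows "ba_simple_expectation M p (\<lambda>\<omega>. S \<omega> + c * T \<omega>)
    = ba_simple_expectation M p S + c * ba_simple_expectation M p T"
proof -
  note comp = ba_simple_expectation_comp[OF additive simple_function_Pair[OF S T]]
  from comp[of "\<lambda>x. fst x + c * snd x"] comp[of fst] comp[of snd] show ?thesis
    by (simp add: sum.distrib sum_distrib_left algebra_simps)
qed

lemma simple_mono:
  assumes S: "simple_function M S" and T: "simple_function M T" and le: "AE \<omega> in M. S \<omega> \<le> T \<omega>"
  shows "ba_simple_expectation M p S \<le> ba_simple_expectation M p T"
proof -
  let ?P = "\<lambda>\<omega>. (S \<omega>, T \<omega>)"
  note ST = simple_function_Pair[OF S T]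
  note comp = ba_simple_expectation_comp[OF additive ST]
  have "(\<Sum>b\<in>?P ` space M. fst b * p (?P -` {b} \<inter> space M))
      \<le> (\<Sum>b\<in>?P ` space M. snd b * p (?P -` {b} \<inter> space M))"
  proof (rule sum_mono)
    fix b
    have A: "?P -` {b} \<inter> space M \<in> sets M" using ST by (rule simple_functionD)
    \<comment> \<open>Pairs of values in the wrong order are taken only on a null set, which \<open>p\<close> does not charge.\<close>
    show "fst b * p (?P -` {b} \<inter> space M) \<le> snd b * p (?P -` {b} \<inter> space M)"
    proof (cases "fst b \<le> snd b")
      case True
      thus ?thesis using nonneg[OF A] by (rule mult_right_mono)
    next
      case False
      have "AE \<omega> in M. \<omega> \<notin> ?P -` {b} \<inter> space M"
        using le by eventually_elim (use False in auto)
      hence "?P -` {b} \<inter> space M \<in> null_sets M" using A by (simp add: AE_iff_null_sets)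
      thus ?thesis by (simp add: null)
    qed
  qed
  with comp[of fst] comp[of snd] show ?thesis by simp
qed

lemma simple_const: "ba_simple_expectation M p (\<lambda>_. c) = c * p (space M)"
  using not_empty by (simp add: ba_simple_expectation_def image_constant_conv)

lemma simple_close:
  assumes S: "simple_function M S" and T: "simple_function M T"
    and le: "AE \<omega> in M. \<bar>S \<omega> - T \<omega>\<bar> \<le> d"
  shows "\<bar>ba_simple_expectation M p S - ba_simple_expectation M p T\<bar> \<le> d * p (space M)"
proof -
  have *: "ba_simple_expectation M p S \<le> ba_simple_expectation M p T + d * p (space M)"
    if S: "simple_function M S" and T: "simple_function M T"
      and le: "AE \<omega> in M. \<bar>S \<omega> - T \<omega>\<bar> \<le> d" for S T
  proof -
    have "ba_simple_expectation M p S \<le> ba_simple_expectation M p (\<lambda>\<omega>. T \<omega> + 1 * d)"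
      by (intro simple_mono S simple_function_add_scale T simple_function_const)
        (use le in eventually_elim, linarith)
    also have "\<dots> = ba_simple_expectation M p T + d * p (space M)"
      using simple_add_scale[OF T simple_function_const, of 1 d] by (simp add: simple_const)
    finally show ?thesis .
  qed
  have "AE \<omega> in M. \<bar>T \<omega> - S \<omega>\<bar> \<le> d" using le by (simp add: abs_minus_commute)
  with *[OF S T le] *[OF T S] show ?thesis by linarith
qed

text \<open>
  The Lipschitz bound \<open>simple_close\<close> turns closeness to the same limit into closeness of elementary
  integrals. With equal sequences this is the Cauchy property; with different ones it shows that the
  limit does not depend on the sequence.
\<close>

lemma approximates_merge:
  assumes X: "X \<in> Linf M" and S: "approximates M S X" and T: "approximates M T X" and e: "0 < e"
  shows "\<exists>N. \<forall>i\<ge>N. \<forall>j\<ge>N.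
    dist (ba_simple_expectation M p (S i)) (ba_simple_expectation M p (T j)) < e"
proof -
  \<comment> \<open>The summand 1 avoids a division by zero when \<open>p\<close> vanishes.\<close>
  define m where "m = p (space M) + 1"
  have m: "0 \<le> p (space M)" "p (space M) < m" using nonneg[of "space M"] by (auto simp: m_def)
  define d where "d = e / (2 * m)"
  have d: "0 < d" using e m by (simp add: d_def)
  have "\<forall>\<^sub>F n in sequentially. AE \<omega> in M. \<bar>S n \<omega> - X \<omega>\<bar> \<le> d"
    "\<forall>\<^sub>F n in sequentially. AE \<omega> in M. \<bar>T n \<omega> - X \<omega>\<bar> \<le> d"
    using S T d by (auto simp: approximates_iff[OF X])
  hence "\<forall>\<^sub>F n in sequentially.
      (AE \<omega> in M. \<bar>S n \<omega> - X \<omega>\<bar> \<le> d) \<and> (AE \<omega> in M. \<bar>T n \<omega> - X \<omega>\<bar> \<le> d)"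
    by (rule eventually_conj)
  then obtain N where N: "AE \<omega> in M. \<bar>S n \<omega> - X \<omega>\<bar> \<le> d" "AE \<omega> in M. \<bar>T n \<omega> - X \<omega>\<bar> \<le> d"
    if "N \<le> n" for n
    unfolding eventually_sequentially by blast
  show ?thesis
  proof (intro exI allI impI)
    fix i j assume "N \<le> i" "N \<le> j"
    from N(1)[OF this(1)] N(2)[OF this(2)]
    have "AE \<omega> in M. \<bar>S i \<omega> - T j \<omega>\<bar> \<le> 2 * d" by eventually_elim linarith
    hence "\<bar>ba_simple_expectation M p (S i) - ba_simple_expectation M p (T j)\<bar>
        \<le> 2 * d * p (space M)"
      using S T by (intro simple_close) (auto simp: approximates_def)
    also have "\<dots> < 2 * d * m" using d m by simp
    also have "\<dots> = e" using m by (simp add: d_def)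
    finally show "dist (ba_simple_expectation M p (S i)) (ba_simple_expectation M p (T j)) < e"
      by (simp add: dist_real_def)
  qed
qed

lemma approximates_limit_unique:
  assumes X: "X \<in> Linf M" and S: "approximates M S X" and T: "approximates M T X"
    and lim: "(\<lambda>n. ba_simple_expectation M p (S n)) \<longlonglongrightarrow> c"
  shows "(\<lambda>n. ba_simple_expectation M p (T n)) \<longlonglongrightarrow> c"
proof (rule Lim_transform[OF lim])
  show "(\<lambda>n. ba_simple_expectation M p (T n) - ba_simple_expectation M p (S n)) \<longlonglongrightarrow> 0"
  proof (rule metric_LIMSEQ_I)
    fix e :: real assume "0 < e"
    from approximates_merge[OF X T S this] show "\<exists>N. \<forall>n\<ge>N.
        dist (ba_simple_expectation M p (T n) - ba_simple_expectation M p (S n)) 0 < e"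
      by (auto simp: dist_real_def)
  qed
qed

lemma approximates_convergent:
  assumes X: "X \<in> Linf M" and S: "approximates M S X"
  shows "convergent (\<lambda>n. ba_simple_expectation M p (S n))"
  using approximates_merge[OF X S S] by (intro Cauchy_convergent metric_CauchyI) blast

text \<open>
  A single approximating sequence determines the integral, although the definition quantifies over all
  of them.
\<close>

lemma ba_expectation_eqI:
  assumes X: "X \<in> Linf M" and S: "approximates M S X"
    and lim: "(\<lambda>n. ba_simple_expectation M p (S n)) \<longlonglongrightarrow> c"
  shows "ba_expectation M p X = c"
proof -
  have "(THE c. \<forall>S. approximates M S X \<longrightarrow> (\<lambda>n. ba_simple_expectation M p (S n)) \<longlonglongrightarrow> c) = c"
  proof (rule the_equality)
    show "\<forall>S. approximates M S X \<longrightarrow> (\<lambda>n. ba_simple_expectation M p (S n)) \<longlonglongrightarrow> c"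
      using approximates_limit_unique[OF X S _ lim] by blast
  next
    fix c' assume "\<forall>S. approximates M S X \<longrightarrow> (\<lambda>n. ba_simple_expectation M p (S n)) \<longlonglongrightarrow> c'"
    with S have "(\<lambda>n. ba_simple_expectation M p (S n)) \<longlonglongrightarrow> c'" by blast
    thus "c' = c" using lim by (rule LIMSEQ_unique)
  qed
  thus ?thesis by (simp add: ba_expectation_def approximates_def)
qed

lemma ba_expectation_limit:
  assumes X: "X \<in> Linf M" and S: "approximates M S X"
  shows "(\<lambda>n. ba_simple_expectation M p (S n)) \<longlonglongrightarrow> ba_expectation M p X"
proof -
  obtain c where "(\<lambda>n. ba_simple_expectation M p (S n)) \<longlonglongrightarrow> c"
    using approximates_convergent[OF X S] by (auto simp: convergent_def)
  with ba_expectation_eqI[OF X S] show ?thesis by simp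
qed

lemma ba_expectation_const: "ba_expectation M p (\<lambda>_. c) = c * p (space M)"
proof (rule ba_expectation_eqI[OF Linf_const])
  show "approximates M (\<lambda>_ _. c) (\<lambda>_. c)"
    by (simp add: approximates_iff[OF Linf_const])
qed (simp add: simple_const)

lemma ba_expectation_add_scale:
  assumes X: "X \<in> Linf M" and Y: "Y \<in> Linf M"
  shows "ba_expectation M p (\<lambda>\<omega>. X \<omega> + c * Y \<omega>) = ba_expectation M p X + c * ba_expectation M p Y"
proof -
  obtain S where S: "approximates M S X" using X by (rule exists_approximates)
  obtain T where T: "approximates M T Y" using Y by (rule exists_approximates)
  have simple: "simple_function M (S n)" "simple_function M (T n)" for n
    using S T by (auto simp: approximates_def)
  show ?thesis
  proof (rule ba_expectation_eqI[OF Linf_add_scale[OF X Y]])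
    show "approximates M (\<lambda>n \<omega>. S n \<omega> + c * T n \<omega>) (\<lambda>\<omega>. X \<omega> + c * Y \<omega>)"
      unfolding approximates_iff[OF Linf_add_scale[OF X Y]]
    proof (intro conjI allI impI)
      fix e :: real assume e: "0 < e"
      define d where "d = e / (1 + \<bar>c\<bar>)"
      have "0 < 1 + \<bar>c\<bar>" by (rule add_pos_nonneg) auto
      hence d: "0 < d" "(1 + \<bar>c\<bar>) * d = e" using e by (auto simp: d_def)
      have "\<forall>\<^sub>F n in sequentially. AE \<omega> in M. \<bar>S n \<omega> - X \<omega>\<bar> \<le> d"
        using S d by (auto simp: approximates_iff[OF X])
      moreover have "\<forall>\<^sub>F n in sequentially. AE \<omega> in M. \<bar>T n \<omega> - Y \<omega>\<bar> \<le> d"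
        using T d by (auto simp: approximates_iff[OF Y])
      ultimately show "\<forall>\<^sub>F n in sequentially.
          AE \<omega> in M. \<bar>S n \<omega> + c * T n \<omega> - (X \<omega> + c * Y \<omega>)\<bar> \<le> e"
      proof eventually_elim
        case (elim n)
        from elim(1) elim(2) show ?case
        proof eventually_elim
          case (elim \<omega>)
          have "\<bar>S n \<omega> + c * T n \<omega> - (X \<omega> + c * Y \<omega>)\<bar>
              = \<bar>(S n \<omega> - X \<omega>) + c * (T n \<omega> - Y \<omega>)\<bar>" by (simp add: algebra_simps)
          also have "\<dots> \<le> \<bar>S n \<omega> - X \<omega>\<bar> + \<bar>c\<bar> * \<bar>T n \<omega> - Y \<omega>\<bar>"
            unfolding abs_mult[symmetric] by (rule abs_triangle_ineq)
          also have "\<dots> \<le> d + \<bar>c\<bar> * d"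
            using elim by (intro add_mono mult_left_mono) auto
          finally show ?case using d(2) by (simp add: algebra_simps)
        qed
      qed
    qed (intro simple_function_add_scale simple)
    show "(\<lambda>n. ba_simple_expectation M p (\<lambda>\<omega>. S n \<omega> + c * T n \<omega>))
        \<longlonglongrightarrow> ba_expectation M p X + c * ba_expectation M p Y"
      unfolding simple_add_scale[OF simple]
      by (intro tendsto_intros ba_expectation_limit X Y S T)
  qed
qed

lemma ba_expectation_le:
  assumes X: "X \<in> Linf M" and le: "AE \<omega> in M. X \<omega> \<le> c"
  shows "ba_expectation M p X \<le> c * p (space M)"
proof -
  obtain S where S: "approximates M S X" using X by (rule exists_approximates)
  have bound: "ba_expectation M p X \<le> (c + e) * p (space M)" if e: "0 < e" for e
  proof (rule tendsto_upperbound[OF ba_expectation_limit[OF X S]])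
    have "\<forall>\<^sub>F n in sequentially. AE \<omega> in M. \<bar>S n \<omega> - X \<omega>\<bar> \<le> e"
      using S e by (auto simp: approximates_iff[OF X])
    thus "\<forall>\<^sub>F n in sequentially. ba_simple_expectation M p (S n) \<le> (c + e) * p (space M)"
    proof eventually_elim
      case (elim n)
      have "AE \<omega> in M. S n \<omega> \<le> c + e" using elim le by eventually_elim linarith
      hence "ba_simple_expectation M p (S n) \<le> ba_simple_expectation M p (\<lambda>_. c + e)"
        using S by (intro simple_mono) (auto simp: approximates_def)
      thus ?case by (simp add: simple_const)
    qed
  qed simp
  show ?thesis
  proof (rule tendsto_lowerbound)
    have "((\<lambda>e. (c + e) * p (space M)) \<longlongrightarrow> (c + 0) * p (space M)) (at_right 0)"
      by (intro tendsto_intros)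
    thus "((\<lambda>e. (c + e) * p (space M)) \<longlongrightarrow> c * p (space M)) (at_right 0)" by simp
    show "\<forall>\<^sub>F e in at_right 0. ba_expectation M p X \<le> (c + e) * p (space M)"
      using eventually_at_right_less[of 0] by (rule eventually_mono) (rule bound)
  qed simp
qed

end

section \<open>The essential supremum and the functionals it dominates\<close>

interpretation Linf: function_space "Linf M" for M :: "'a measure"
  by unfold_locales (auto intro: Linf_const Linf_add Linf_scale)

text \<open>
  A real-valued essential supremum, so that it is a sublinear functional on $L^\infty$; the infimum is
  meaningful for almost surely bounded functions on a probability space.
\<close>

definition real_esssup :: "'a measure \<Rightarrow> ('a \<Rightarrow> real) \<Rightarrow> real" where
  "real_esssup M X = Inf {c. AE \<omega> in M. X \<omega> \<le> c}"

context prob_space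
begin

lemma real_esssup_le:
  assumes X: "X \<in> Linf M" and le: "AE \<omega> in M. X \<omega> \<le> c"
  shows "real_esssup M X \<le> c"
proof -
  obtain C where C: "AE \<omega> in M. \<bar>X \<omega>\<bar> \<le> C" using X by (rule Linf_bound)
  have "- C \<le> b" if "AE \<omega> in M. X \<omega> \<le> b" for b
  proof -
    have "AE \<omega> in M. - C \<le> b" using C that by eventually_elim linarith
    thus ?thesis by simp
  qed
  hence "bdd_below {c. AE \<omega> in M. X \<omega> \<le> c}" by (intro bdd_belowI[of _ "- C"]) simp
  thus ?thesis unfolding real_esssup_def using le by (intro cInf_lower) auto
qed

lemma le_real_esssup:
  assumes X: "X \<in> Linf M" and ge: "\<And>c. AE \<omega> in M. X \<omega> \<le> c \<Longrightarrow> a \<le> c"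
  shows "a \<le> real_esssup M X"
proof -
  obtain C where C: "AE \<omega> in M. \<bar>X \<omega>\<bar> \<le> C" using X by (rule Linf_bound)
  hence "AE \<omega> in M. X \<omega> \<le> C" by eventually_elim linarith
  thus ?thesis unfolding real_esssup_def using ge by (intro cInf_greatest) auto
qed

lemma sublinear_real_esssup: "Linf.sublinear M (real_esssup M)"
proof (rule Linf.sublinearI)
  fix X Y assume X: "X \<in> Linf M" and Y: "Y \<in> Linf M"
  have le: "real_esssup M (\<lambda>\<omega>. X \<omega> + Y \<omega>) \<le> a + b"
    if "AE \<omega> in M. X \<omega> \<le> a" "AE \<omega> in M. Y \<omega> \<le> b" for a b
  proof (rule real_esssup_le[OF Linf_add[OF X Y]])
    show "AE \<omega> in M. X \<omega> + Y \<omega> \<le> a + b" using that by eventually_elim simp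
  qed
  have "real_esssup M (\<lambda>\<omega>. X \<omega> + Y \<omega>) - a \<le> real_esssup M Y" if "AE \<omega> in M. X \<omega> \<le> a" for a
    using le[OF that] by (intro le_real_esssup Y) (simp add: algebra_simps)
  hence "real_esssup M (\<lambda>\<omega>. X \<omega> + Y \<omega>) - real_esssup M Y \<le> real_esssup M X"
    by (intro le_real_esssup X) (simp add: algebra_simps)
  thus "real_esssup M (\<lambda>\<omega>. X \<omega> + Y \<omega>) \<le> real_esssup M X + real_esssup M Y" by simp
next
  show "real_esssup M (\<lambda>_. 0) = 0"
    by (intro antisym real_esssup_le le_real_esssup Linf_const) auto
next
  fix X and t :: real assume X: "X \<in> Linf M" and t: "0 < t"
  have "real_esssup M (\<lambda>\<omega>. t * X \<omega>) / t \<le> real_esssup M X"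
  proof (rule le_real_esssup[OF X])
    fix c assume "AE \<omega> in M. X \<omega> \<le> c"
    hence "AE \<omega> in M. t * X \<omega> \<le> t * c" by eventually_elim (use t in simp)
    hence "real_esssup M (\<lambda>\<omega>. t * X \<omega>) \<le> t * c" by (intro real_esssup_le Linf_scale X)
    thus "real_esssup M (\<lambda>\<omega>. t * X \<omega>) / t \<le> c" using t by (simp add: field_simps)
  qed
  thus "real_esssup M (\<lambda>\<omega>. t * X \<omega>) \<le> t * real_esssup M X" using t by (simp add: field_simps)
qed

lemma fa_probs_iff: "p \<in> fa_probs M \<longleftrightarrow> p \<in> ba_pos M \<and> p (space M) = 1"
proof (cases "p \<in> ba_pos M")
  case True
  then interpret fa_measure M p by unfold_locales
  show ?thesis using True ba_expectation_const[of 1] by (simp add: fa_probs_def)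
qed (simp add: fa_probs_def)

lemma Linf_indicator: "A \<in> sets M \<Longrightarrow> (indicator A :: 'a \<Rightarrow> real) \<in> Linf M"
  by (rule Linf_I[of _ _ 1]) (auto simp: indicator_def)

text \<open>
  Domination by the essential supremum says that \<open>f\<close> is positive (so it respects almost sure equality
  and is continuous in the norm) and that it maps the constant 1 to 1. Its values on indicators
  therefore form a finitely additive probability, whose integral agrees with \<open>f\<close> on simple functions by
  linearity and on all of $L^\infty$ by density.
\<close>

lemma functional_represented_by_fa_prob:
  assumes lin: "Linf.linear_functional M f"
    and le: "\<And>X. X \<in> Linf M \<Longrightarrow> f X \<le> real_esssup M X"
  obtains p where "p \<in> fa_probs M" "\<And>X. X \<in> Linf M \<Longrightarrow> ba_expectation M p X = f X"
proof -
  have add: "f (\<lambda>\<omega>. X \<omega> + Y \<omega>) = f X + f Y" if "X \<in> Linf M" "Y \<in> Linf M" for X Y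
    using lin that by (simp add: Linf.linear_functional_def)
  have scale: "f (\<lambda>\<omega>. c * X \<omega>) = c * f X" if "X \<in> Linf M" for X c
    using lin that by (simp add: Linf.linear_functional_def)
  have minus: "f (\<lambda>\<omega>. X \<omega> - Y \<omega>) = f X - f Y" if "X \<in> Linf M" "Y \<in> Linf M" for X Y
    using add[OF that(1) Linf_scale[OF that(2)], of "-1"] scale[OF that(2), of "-1"] by simp
  have upper: "f X \<le> c" if "X \<in> Linf M" "AE \<omega> in M. X \<omega> \<le> c" for X c
    using le[OF that(1)] real_esssup_le[OF that] by simp
  have mono: "f X \<le> f Y + c" if X: "X \<in> Linf M" and Y: "Y \<in> Linf M"
    and XY: "AE \<omega> in M. X \<omega> \<le> Y \<omega> + c" for X Y c
  proof -
    have "(\<lambda>\<omega>. X \<omega> - Y \<omega>) \<in> Linf M" using Linf_add_scale[OF X Y, of "-1"] by simp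
    hence "f (\<lambda>\<omega>. X \<omega> - Y \<omega>) \<le> c"
      by (rule upper) (use XY in eventually_elim, linarith)
    with minus[OF X Y] show ?thesis by simp
  qed
  have cong: "f X = f Y" if X: "X \<in> Linf M" and Y: "Y \<in> Linf M"
    and XY: "AE \<omega> in M. X \<omega> = Y \<omega>" for X Y
  proof (rule antisym)
    show "f X \<le> f Y" using mono[OF X Y, of 0] AE_mp[OF XY] by simp
    show "f Y \<le> f X" using mono[OF Y X, of 0] AE_mp[OF XY] by simp
  qed
  have one: "f (\<lambda>_. 1) = 1"
  proof (rule antisym)
    show "f (\<lambda>_. 1) \<le> 1" by (intro upper Linf_const) simp
    have "f (\<lambda>_. - 1) \<le> - 1" by (intro upper Linf_const) simp
    thus "1 \<le> f (\<lambda>_. 1)" using scale[OF Linf_const, of "-1" 1] by simp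
  qed
  have zero: "f (\<lambda>_. 0) = 0" using scale[OF Linf_const, of 0 0] by simp
  have f_sum: "f (\<lambda>\<omega>. \<Sum>i\<in>I. X i \<omega>) = (\<Sum>i\<in>I. f (X i)) \<and> (\<lambda>\<omega>. \<Sum>i\<in>I. X i \<omega>) \<in> Linf M"
    if "finite I" "\<And>i. i \<in> I \<Longrightarrow> X i \<in> Linf M" for I :: "real set" and X
    using that by (induction I) (auto simp: zero add Linf_const intro: Linf_add)
  define p where "p A = f (indicator A)" for A
  have additive: "Measure_Space.additive (sets M) p"
    unfolding Measure_Space.additive_def
  proof (intro ballI impI)
    fix A B assume A: "A \<in> sets M" and B: "B \<in> sets M" and "A \<inter> B = {}"
    hence "indicator (A \<union> B) = (\<lambda>\<omega>. indicator A \<omega> + indicator B \<omega> :: real)"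
      by (auto simp: fun_eq_iff indicator_def)
    with add[OF Linf_indicator[OF A] Linf_indicator[OF B]]
    show "p (A \<union> B) = p A + p B" by (simp add: p_def)
  qed
  have nonneg: "0 \<le> p A" if A: "A \<in> sets M" for A
    using mono[OF Linf_const[of 0] Linf_indicator[OF A], of 0] by (simp add: zero p_def)
  have "p (space M) = f (\<lambda>_. 1)"
    unfolding p_def by (intro cong Linf_indicator Linf_const) auto
  with one have p_space: "p (space M) = 1" by simp
  have "p \<in> ba_pos M"
    unfolding ba_pos_def ba_def
  proof (intro CollectI conjI ballI)
    show "bdd_above {\<Sum>A\<in>P. \<bar>p A\<bar> | P. finite P \<and> P \<subseteq> sets M \<and> partition_on (space M) P}"
    \<comment> \<open>By positivity the variation over any finite partition is the total mass.\<close>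
    proof (rule bdd_aboveI, clarify)
      fix P assume P: "finite P" "P \<subseteq> sets M" "partition_on (space M) P"
      have "(\<Sum>A\<in>P. \<bar>p A\<bar>) = (\<Sum>A\<in>P. p A)" using P(2) nonneg by (intro sum.cong) auto
      also have "\<dots> = p (\<Union>A\<in>P. A)"
        using P by (intro additive_sum_real[OF additive, symmetric])
          (auto simp: partition_on_def disjoint_def disjoint_family_on_def)
      also have "(\<Union>A\<in>P. A) = space M" using P(3) by (simp add: partition_on_def)
      finally show "(\<Sum>A\<in>P. \<bar>p A\<bar>) \<le> 1" by (simp add: p_space)
    qed
    fix N assume "N \<in> null_sets M"
    hence "AE \<omega> in M. indicator N \<omega> = (0::real)"
      by (auto dest!: AE_not_in simp: indicator_def elim!: eventually_mono)
    hence "p N = f (\<lambda>_. 0)"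
      unfolding p_def using \<open>N \<in> null_sets M\<close>
      by (intro cong Linf_indicator Linf_const) auto
    with zero show "p N = 0" by simp
  qed (use additive nonneg in auto)
  then interpret fa_measure M p by unfold_locales
  have simple: "ba_simple_expectation M p S = f S" if S: "simple_function M S" for S
  proof -
    have fin: "finite (S ` space M)" and sets: "\<And>y. S -` {y} \<inter> space M \<in> sets M"
      using S by (auto dest: simple_functionD)
    let ?T = "\<lambda>\<omega>. \<Sum>y\<in>S ` space M. y * indicator (S -` {y} \<inter> space M) \<omega>"
    have T: "f ?T = (\<Sum>y\<in>S ` space M. f (\<lambda>\<omega>. y * indicator (S -` {y} \<inter> space M) \<omega>))"
      "?T \<in> Linf M"
      using f_sum[OF fin, of "\<lambda>y \<omega>. y * indicator (S -` {y} \<inter> space M) \<omega>"]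
      by (auto intro: Linf_scale Linf_indicator sets)
    have "ba_simple_expectation M p S = f ?T"
      unfolding T(1) ba_simple_expectation_def p_def
      by (intro sum.cong refl scale[symmetric] Linf_indicator sets)
    also have "f ?T = f S"
    proof (rule cong[OF T(2) simple_function_Linf[OF S]], rule AE_I2)
      fix \<omega> assume \<omega>: "\<omega> \<in> space M"
      have "?T \<omega> = (\<Sum>y\<in>S ` space M. if S \<omega> = y then y else 0)"
        using \<omega> by (intro sum.cong) (auto simp: indicator_def)
      thus "?T \<omega> = S \<omega>" using \<omega> fin by simp
    qed
    finally show ?thesis .
  qed
  have "ba_expectation M p X = f X" if X: "X \<in> Linf M" for X
  proof -
    obtain S where S: "approximates M S X" using X by (rule exists_approximates)
    have SL: "S n \<in> Linf M" for n using S by (auto simp: approximates_def intro: simple_function_Linf)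
    show ?thesis
    proof (rule ba_expectation_eqI[OF X S], rule tendstoI)
      fix e :: real assume e: "0 < e"
      hence "0 < e / 2" by simp
      hence "\<forall>\<^sub>F n in sequentially. AE \<omega> in M. \<bar>S n \<omega> - X \<omega>\<bar> \<le> e / 2"
        using S unfolding approximates_iff[OF X] by blast
      thus "\<forall>\<^sub>F n in sequentially. dist (ba_simple_expectation M p (S n)) (f X) < e"
      proof eventually_elim
        case (elim n)
        have "f (S n) \<le> f X + e / 2"
          by (rule mono[OF SL X]) (use elim in eventually_elim, linarith)
        moreover have "f X \<le> f (S n) + e / 2"
          by (rule mono[OF X SL]) (use elim in eventually_elim, linarith)
        moreover have "ba_simple_expectation M p (S n) = f (S n)"
          using S by (intro simple) (simp add: approximates_def)
        ultimately show ?case using e by (simp add: dist_real_def abs_less_iff)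
      qed
    qed
  qed
  with ba_pos p_space show thesis by (intro that[of p]) (auto simp: fa_probs_iff)
qed

text \<open>
  Linear programming duality for a single constraint: the maximum equals
  $\inf_{t \ge 0} \mathrm{ess\,sup}(X + tY)$, where \<open>t\<close> is the multiplier of the constraint
  $E_p[Y] \ge 0$. The hypothesis $\mathrm{ess\,sup}\,Y \ge 0$ is feasibility.
\<close>

lemma constrained_expectation_maximum:
  assumes X: "X \<in> Linf M" and Y: "Y \<in> Linf M" and Y_upper: "0 \<le> real_esssup M Y"
  shows "is_maximum {ba_expectation M p X | p. p \<in> fa_probs M \<and> ba_expectation M p Y \<ge> 0}
    (Linf.tilt (real_esssup M) Y 0 X)"
proof -
  let ?q = "Linf.tilt (real_esssup M) Y 0"
  note tilt = sublinear_real_esssup Y Y_upper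
  obtain f where lin: "Linf.linear_functional M f" and f_le: "\<And>Z. Z \<in> Linf M \<Longrightarrow> f Z \<le> ?q Z"
    and fX: "f X = ?q X"
    using Linf.dominated_linear_functional[OF
      Linf.sublinear_tilt[where p = "real_esssup M" and x = Y and c = 0, OF tilt] X] by blast
  have "f Z \<le> real_esssup M Z" if "Z \<in> Linf M" for Z
    using f_le[OF that] Linf.tilt_le_self[where p = "real_esssup M" and x = Y and c = 0, OF
        tilt that] by simp
  then obtain p where p: "p \<in> fa_probs M" "\<And>Z. Z \<in> Linf M \<Longrightarrow> ba_expectation M p Z = f Z"
    using functional_represented_by_fa_prob[OF lin] by blast
  have "f (\<lambda>\<omega>. - Y \<omega>) \<le> 0"
    using f_le[OF Linf_uminus[OF Y]]
      Linf.tilt_uminus[where p = "real_esssup M" and x = Y and c = 0, OF tilt] by simp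
  moreover have "f (\<lambda>\<omega>. - 1 * Y \<omega>) = - 1 * f Y"
    using lin Y unfolding Linf.linear_functional_def by blast
  ultimately have "0 \<le> ba_expectation M p Y" using p(2)[OF Y] by simp
  moreover have "ba_expectation M p X = ?q X" using p(2)[OF X] fX by simp
  moreover have "ba_expectation M p' X \<le> ?q X"
    if p': "p' \<in> fa_probs M" and pY: "0 \<le> ba_expectation M p' Y" for p'
  proof (rule Linf.tilt_greatest[where p = "real_esssup M" and x = Y and c = 0, OF tilt])
    fix t :: real assume t: "0 \<le> t"
    interpret fa_measure M p' using p' by unfold_locales (simp add: fa_probs_iff)
    have "ba_expectation M p' X \<le> ba_expectation M p' X + t * ba_expectation M p' Y"
      using t pY by simp
    also have "\<dots> = ba_expectation M p' (\<lambda>\<omega>. X \<omega> + t * Y \<omega>)"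
      by (rule ba_expectation_add_scale[OF X Y, symmetric])
    also have "\<dots> \<le> real_esssup M (\<lambda>\<omega>. X \<omega> + t * Y \<omega>)"
      using ba_expectation_le[OF Linf_add_scale[OF X Y]] p'
      by (intro le_real_esssup Linf_add_scale X Y) (auto simp: fa_probs_iff)
    finally show "ba_expectation M p' X \<le> real_esssup M (\<lambda>\<omega>. X \<omega> + t * Y \<omega>) - t * 0" by simp
  qed
  ultimately show ?thesis using p(1) unfolding is_maximum_def by (auto intro!: exI[of _ p])
qed

end

section \<open>The min-max representation\<close>

theorem corollary4p2:
  fixes M :: "'a measure" and \<mu> :: "('a \<Rightarrow> real) \<Rightarrow> real"
  assumes "prob_space M"
    and "risk_measure M \<mu>"
    and "pos_homogeneous M \<mu>"
  shows "\<forall>X\<in>Linf M.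
    (\<forall>Y\<in>Linf M. \<mu> Y = 0 \<longrightarrow>
       (\<exists>m. is_maximum {ba_expectation M p (\<lambda>\<omega>. - X \<omega>) | p.
                          p \<in> fa_probs M \<and> ba_expectation M p Y \<ge> 0} m)) \<and>
    is_minimum {m. \<exists>Y\<in>Linf M. \<mu> Y = 0 \<and>
                   is_maximum {ba_expectation M p (\<lambda>\<omega>. - X \<omega>) | p.
                                 p \<in> fa_probs M \<and> ba_expectation M p Y \<ge> 0} m} (\<mu> X)"
proof -
  interpret prob_space M by (rule assms(1))
  have mono: "\<mu> Y \<le> \<mu> X" if "X \<in> Linf M" "Y \<in> Linf M" "AE \<omega> in M. X \<omega> \<le> Y \<omega>" for X Y
    using assms(2) that by (simp add: risk_measure_def)
  have shift: "\<mu> (\<lambda>\<omega>. X \<omega> + l) = \<mu> X - l" if "X \<in> Linf M" for X l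
    using assms(2) that by (simp add: risk_measure_def)
  have scale: "\<mu> (\<lambda>\<omega>. t * X \<omega>) = t * \<mu> X" if "X \<in> Linf M" "0 \<le> t" for X t
    using assms(3) that by (simp add: pos_homogeneous_def)
  have zero: "\<mu> (\<lambda>_. 0) = 0" using scale[OF Linf_const, of 0 0] by simp
  have const: "\<mu> (\<lambda>_. c) = - c" for c using shift[OF Linf_const, of 0 c] zero by simp
  let ?E = "\<lambda>X Y. {ba_expectation M p (\<lambda>\<omega>. - X \<omega>) | p. p \<in> fa_probs M \<and> ba_expectation M p Y \<ge> 0}"
  let ?m = "\<lambda>X Y. Linf.tilt (real_esssup M) Y 0 (\<lambda>\<omega>. - X \<omega>)"
  \<comment> \<open>An acceptable position at the boundary cannot be a sure loss bounded away from zero.\<close>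
  have upper: "0 \<le> real_esssup M Y" if Y: "Y \<in> Linf M" "\<mu> Y = 0" for Y
  proof (rule le_real_esssup[OF Y(1)])
    fix c assume "AE \<omega> in M. Y \<omega> \<le> c"
    from mono[OF Y(1) Linf_const this] show "0 \<le> c" using Y(2) const by simp
  qed
  have max: "is_maximum (?E X Y) (?m X Y)" if "X \<in> Linf M" "Y \<in> Linf M" "\<mu> Y = 0" for X Y
    using that by (intro constrained_expectation_maximum Linf_uminus upper)
  have ge: "\<mu> X \<le> ?m X Y" if X: "X \<in> Linf M" and Y: "Y \<in> Linf M" "\<mu> Y = 0" for X Y
  proof (rule Linf.tilt_greatest[where p = "real_esssup M" and x = Y and c = 0, OF
      sublinear_real_esssup Y(1) upper[OF Y]])
    fix t :: real assume t: "0 \<le> t"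
    have "\<mu> X \<le> real_esssup M (\<lambda>\<omega>. - X \<omega> + t * Y \<omega>)"
    proof (rule le_real_esssup[OF Linf_add_scale[OF Linf_uminus[OF X] Y(1)]])
      fix c assume "AE \<omega> in M. - X \<omega> + t * Y \<omega> \<le> c"
      hence "AE \<omega> in M. t * Y \<omega> \<le> X \<omega> + c" by eventually_elim linarith
      hence "\<mu> (\<lambda>\<omega>. X \<omega> + c) \<le> \<mu> (\<lambda>\<omega>. t * Y \<omega>)"
        by (intro mono Linf_scale Linf_add Linf_const X Y)
      thus "\<mu> X \<le> c" using shift[OF X, of c] scale[OF Y(1) t] Y(2) by simp
    qed
    thus "\<mu> X \<le> real_esssup M (\<lambda>\<omega>. - X \<omega> + t * Y \<omega>) - t * 0" by simp
  qed
  show ?thesis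
  proof (intro ballI conjI impI)
    fix X Y assume "X \<in> Linf M" "Y \<in> Linf M" "\<mu> Y = 0"
    thus "\<exists>m. is_maximum (?E X Y) m" using max by blast
  next
    fix X assume X: "X \<in> Linf M"
    \<comment> \<open>The constraint for this \<open>Y\<close> reads \<open>E_p[-X] \<le> \<mu> X\<close>, the bound that \<open>t = 1\<close> gives.\<close>
    define Y where "Y = (\<lambda>\<omega>. X \<omega> + \<mu> X)"
    have Y: "Y \<in> Linf M" "\<mu> Y = 0"
      using X shift[OF X] by (auto simp: Y_def intro: Linf_add Linf_const)
    have "?m X Y \<le> real_esssup M (\<lambda>\<omega>. - X \<omega> + 1 * Y \<omega>) - 1 * 0"
      by (rule Linf.tilt_le[where p = "real_esssup M" and x = Y and c = 0, OF
            sublinear_real_esssup Y(1) upper[OF Y]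
            Linf_uminus[OF X] zero_le_one])
    also have "\<dots> \<le> \<mu> X"
      using real_esssup_le[OF Linf_const, of "\<mu> X" "\<mu> X"] by (simp add: Y_def)
    finally have "?m X Y = \<mu> X" using ge[OF X Y] by simp
    with max[OF X Y] have "is_maximum (?E X Y) (\<mu> X)" by simp
    moreover have "\<mu> X \<le> m" if "Z \<in> Linf M" "\<mu> Z = 0" "is_maximum (?E X Z) m" for Z m
    proof -
      have "m = ?m X Z"
        using that(3) max[OF X that(1,2)] unfolding is_maximum_def by (blast intro: antisym)
      with ge[OF X that(1,2)] show ?thesis by simp
    qed
    ultimately show "is_minimum {m. \<exists>Y\<in>Linf M. \<mu> Y = 0 \<and> is_maximum (?E X Y) m} (\<mu> X)"
      using Y unfolding is_minimum_def by blast
  qed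
qed

end
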